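(* Let $W$ be an $m\times n$ stochastic matrix, not all of whose rows are equal and none of whose columns is identically zero. Let $r\in\mathbf{R}^{1\times m}$, $f\in\mathbf{R}^{1\times n}$ be an admissible pair of nonnegative vectors for $W$, with associated $\tilde W$ and $c$, and let $(p^{(t)})_{t\ge 0}$ be a sequence generated by Algorithm III (all defined in the context). Then $\lim_{t\to\infty}p^{(t)}=:p^{(\infty)}$ exists, and $I(p^{(t)}|\tilde W,f,c)$ is nondecreasing in $t$ and converges, as $t\to\infty$, to $$\sup_{p\in\Omega(r)} I(p|\tilde W,f,c).$$
   Context: Vectors are row vectors except that $1_m$, $1_n$ denote the column vectors of ones; $I_m$ is the identity matrix; inequalities between vectors or matrices are entrywise; $W_i$ is the $i$th row of a matrix $W$. A matrix is stochastic if it has nonnegative entries and all row sums equal to 1. $\Omega=\{p\in\mathbf{R}^{1\times m}: p\ge 0,\ p1_m=1\}$ and $\Omega(r)=\{p\in\Omega: p\ge r\}$. Logarithms are natural and $0\log 0=0\log(0/a)=0$. For a nonnegative vector $q$ (not necessarily summing to 1), $H(q)=-\sum_i q_i\log q_i$; for nonnegative vectors $q,s$, $D(q\|s)=\sum_i q_i\log(q_i/s_i)$. For an $m\times n$ stochastic matrix $V$, a $1\times n$ vector $f\ge0$, a $1\times m$ vector $c$ and $p\in\Omega$, $$I(p|V,f,c)=\sum_i p_i\big(D(V_i\|f+pV)+c_i\big)+D(f\|f+pV),$$ equivalently $I(p|V,f,c)=H(pV+f)+\sum_i p_i(c_i-H(V_i))-H(f)$. Admissible pair: nonnegative vectors $r$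 ($1\times m$) and $f$ ($1\times n$), with $r_+=r1_m$, $f_+=f1_n$, such that $r_+<1$ and $$\tilde W:=(1+f_+)\frac{I_m-1_m r}{1-r_+}W-1_m f\ \ge 0$$ (then $\tilde W$ is stochastic). The associated vector $c$ is $c_i=H(\tilde W_i)-\frac{1+f_+}{1-r_+}H(W_i)$, $1\le i\le m$. Algorithm III: choose $p^{(0)}\in\Omega(r)$ with $p^{(0)}_i>0$ for all $i$. For $t=0,1,\dots$ set $$\Phi^{(t)}_{ji}=\frac{p_i^{(t)}\tilde W_{ij}}{f_j+\sum_l p_l^{(t)}\tilde W_{lj}},\qquad p_i^{(t+1)}=\max\Big\{r_i,\ \alpha^{(t)}\exp\Big(c_i+\sum_j\tilde W_{ij}\log\Phi^{(t)}_{ji}\Big)\Big\},$$ where $\alpha^{(t)}>0$ is chosen so that $\sum_i p_i^{(t+1)}=1$ (terms with $\tilde W_{ij}=0$ contribute $0$ to the sum in the exponent). *)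

theory Defs
  imports "HOL-Analysis.Analysis"
begin

text \<open>
  An $m \times n$ matrix is an element of \<open>real^'n^'m\<close>, so \<open>W $ i\<close> is its $i$th row, \<open>p v* W\<close> is the
  row vector $pW$, and \<open>\<le>\<close> on vectors and matrices is the entrywise order.
  The matrix $1_m r$, all of whose rows are $r$, is written \<open>\<chi> i. r\<close>.
\<close>

abbreviation total :: "real^'k \<Rightarrow> real" where
  "total q \<equiv> \<Sum>i\<in>UNIV. q $ i"

definition stochastic :: "real^'n^'m \<Rightarrow> bool" where
  "stochastic V \<longleftrightarrow> 0 \<le> V \<and> (\<forall>i. total (V $ i) = 1)"

definition Omega :: "(real^'m) set" where
  "Omega = {p. 0 \<le> p \<and> total p = 1}"

definition Omega_ge :: "real^'m \<Rightarrow> (real^'m) set" where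
  "Omega_ge r = {p \<in> Omega. r \<le> p}"

definition H :: "real^'k \<Rightarrow> real" where
  "H q = - (\<Sum>i\<in>UNIV. q $ i * ln (q $ i))"

text \<open>
  Real-valued divergence: a term with $q_i > 0 = s_i$ (conventionally $+\infty$) evaluates to 0 here.
  In \<open>I_fun\<close> below, for nonnegative \<open>p\<close>, \<open>V\<close> and \<open>f\<close>, such a term of $D(V_i \| f + pV)$ occurs only
  if $p_i = 0$, and then it is multiplied by $p_i$; it never occurs in $D(f \| f + pV)$.
\<close>

definition D :: "real^'k \<Rightarrow> real^'k \<Rightarrow> real" where
  "D q s = (\<Sum>i\<in>UNIV. q $ i * ln (q $ i / s $ i))"

definition I_fun :: "real^'m \<Rightarrow> real^'n^'m \<Rightarrow> real^'n \<Rightarrow> real^'m \<Rightarrow> real" where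
  "I_fun p V f c =
     (\<Sum>i\<in>UNIV. p $ i * (D (V $ i) (f + p v* V) + c $ i)) + D f (f + p v* V)"

definition W_tilde :: "real^'n^'m \<Rightarrow> real^'m \<Rightarrow> real^'n \<Rightarrow> real^'n^'m" where
  "W_tilde W r f =
     ((1 + total f) / (1 - total r)) *\<^sub>R ((mat 1 - (\<chi> i. r)) ** W) - (\<chi> i. f)"

definition admissible :: "real^'n^'m \<Rightarrow> real^'m \<Rightarrow> real^'n \<Rightarrow> bool" where
  "admissible W r f \<longleftrightarrow> 0 \<le> r \<and> 0 \<le> f \<and> total r < 1 \<and> 0 \<le> W_tilde W r f"

definition c_vec :: "real^'n^'m \<Rightarrow> real^'m \<Rightarrow> real^'n \<Rightarrow> real^'m" where
  "c_vec W r f =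
     (\<chi> i. H (W_tilde W r f $ i) - (1 + total f) / (1 - total r) * H (W $ i))"

definition Phi :: "real^'m \<Rightarrow> real^'n^'m \<Rightarrow> real^'n \<Rightarrow> real^'m^'n" where
  "Phi p V f = (\<chi> j i. p $ i * V $ i $ j / (f $ j + (\<Sum>l\<in>UNIV. p $ l * V $ l $ j)))"

definition algorithm_III ::
    "real^'n^'m \<Rightarrow> real^'m \<Rightarrow> real^'n \<Rightarrow> (nat \<Rightarrow> real^'m) \<Rightarrow> bool" where
  "algorithm_III W r f p \<longleftrightarrow>
     p 0 \<in> Omega_ge r \<and> (\<forall>i. 0 < p 0 $ i) \<and>
     (\<forall>t. \<exists>\<alpha>>0.
        (\<forall>i. p (Suc t) $ i =
           max (r $ i)
             (\<alpha> * exp (c_vec W r f $ i +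
                (\<Sum>j\<in>UNIV. W_tilde W r f $ i $ j * ln (Phi (p t) (W_tilde W r f) f $ j $ i))))) \<and>
        total (p (Suc t)) = 1)"

end

theory Submission
  imports Defs
begin

text \<open>
  Write $q_s = f + sV$ and $g_i(p) = c_i - H(V_i) - \sum_j V_{ij} \log q_{p,j}$, where $V$ is
  \<open>W_tilde W r f\<close>. One step of the algorithm is
  $p'_i = \max\{r_i, \alpha p_i e^{g_i(p)}\}$, that is, mirror ascent for the relative
  entropy with step size 1. Indeed $I(s) = I(p) + \langle g(p), s - p\rangle - D(q_s \| q_p)$, and
  $0 \le D(q_s \| q_p) \le D(s \| p)$. Together with the optimality conditions for $p'$ this gives
  $I(s) - I(p') \le D(s \| p) - D(s \| p')$ for all $s \in \Omega(r)$. With $s = p$ this yields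
  monotonicity; summing over the steps yields convergence of the values to the maximum. A cluster
  point $s$ of the sequence is then a maximizer, so $D(s \| p^{(t)})$ is nonincreasing, and hence
  tends to 0.
\<close>

section \<open>Relative entropy\<close>

text \<open>The map \<open>(a, b)\<close> to \<open>a * ln (a / b)\<close> is convex and
  homogeneous; the left side is its supporting linear function along the ray
  \<open>a = b * k\<close>. The bound is \<open>ln x \<le> x - 1\<close> at
  \<open>x = b * k / a\<close>.\<close>

lemma mult_ln_div_ge:
  fixes a b :: real
  assumes "0 \<le> a" "0 \<le> b" "b = 0 \<Longrightarrow> a = 0" "0 < k"
  shows "a * ln k + a - b * k \<le> a * ln (a / b)"
proof (cases "a = 0")
  case True
  then show ?thesis using assms by simp
next
  case False
  then have ab: "0 < a" "0 < b" using assms by (auto simp: less_le)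
  have "ln (b * k / a) \<le> b * k / a - 1"
    using ab assms by (intro ln_le_minus_one) auto
  moreover have "ln (b * k / a) = ln k - ln (a / b)"
    using ab assms by (simp add: ln_div ln_mult)
  ultimately have "a * (ln k - ln (a / b)) \<le> a * (b * k / a - 1)"
    using ab by (metis less_imp_le mult_left_mono)
  then show ?thesis using ab by (simp add: algebra_simps)
qed

text \<open>Apply the supporting bound to both terms with the same slope
  \<open>k = (a + a') / (b + b')\<close>. The linear corrections then cancel, since
  \<open>(b + b') * k = a + a'\<close>.\<close>

lemma log_sum_inequality2:
  fixes a b a' b' :: real
  assumes "0 \<le> a" "0 \<le> b" "b = 0 \<Longrightarrow> a = 0" "0 \<le> a'" "0 \<le> b'" "b' = 0 \<Longrightarrow> a' = 0"
  shows "(a + a') * ln ((a + a') / (b + b')) \<le> a * ln (a / b) + a' * ln (a' / b')"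
proof (cases "a + a' = 0")
  case True
  then have "a = 0" "a' = 0" using assms by auto
  then show ?thesis by simp
next
  case False
  then have pos: "0 < a + a'" "0 < b + b'" using assms by (auto simp: less_le add_nonneg_eq_0_iff)
  define k where "k = (a + a') / (b + b')"
  have "0 < k" and k: "(b + b') * k = a + a'" using pos by (auto simp: k_def)
  have "a * ln k + a - b * k + (a' * ln k + a' - b' * k) \<le> a * ln (a / b) + a' * ln (a' / b')"
    using assms \<open>0 < k\<close> by (intro add_mono mult_ln_div_ge) auto
  then show ?thesis using k by (simp add: k_def[symmetric] algebra_simps)
qed

lemma log_sum_inequality:
  fixes a b :: "'i \<Rightarrow> real"
  assumes "finite S" "\<And>i. i \<in> S \<Longrightarrow> 0 \<le> a i" "\<And>i. i \<in> S \<Longrightarrow> 0 \<le> b i"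
    "\<And>i. i \<in> S \<Longrightarrow> b i = 0 \<Longrightarrow> a i = 0"
  shows "(\<Sum>i\<in>S. a i) * ln ((\<Sum>i\<in>S. a i) / (\<Sum>i\<in>S. b i)) \<le> (\<Sum>i\<in>S. a i * ln (a i / b i))"
  using assms
proof (induction S rule: finite_induct)
  case empty
  then show ?case by simp
next
  case (insert x S)
  have z: "sum b S = 0 \<Longrightarrow> sum a S = 0"
    using insert by (simp add: sum_nonneg_eq_0_iff)
  have "(\<Sum>i\<in>insert x S. a i) * ln ((\<Sum>i\<in>insert x S. a i) / (\<Sum>i\<in>insert x S. b i))
      \<le> a x * ln (a x / b x) + sum a S * ln (sum a S / sum b S)"
    using insert z by (simp, intro log_sum_inequality2) (auto intro: sum_nonneg)
  then show ?case using insert by force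
qed

text \<open>Writing \<open>ln (s / p)\<close> as \<open>-2 * ln (sqrt p / sqrt s)\<close> and using
  \<open>ln x \<le> x - 1\<close> bounds each term below by
  \<open>2 * s - 2 * sqrt s * sqrt p\<close>. Equal totals turn the sum of these into the squared
  Hellinger distance. This gives nonnegativity of \<open>D\<close> and lets \<open>D\<close> control
  convergence.\<close>

lemma D_ge_hellinger:
  fixes s p :: "real^'k"
  assumes "\<And>i. 0 \<le> s $ i" "\<And>i. 0 \<le> p $ i" "\<And>i. p $ i = 0 \<Longrightarrow> s $ i = 0" "total s = total p"
  shows "(\<Sum>i\<in>UNIV. (sqrt (s $ i) - sqrt (p $ i))\<^sup>2) \<le> D s p"
proof -
  have *: "2 * s $ i - 2 * sqrt (s $ i) * sqrt (p $ i) \<le> s $ i * ln (s $ i / p $ i)" for i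
  proof (cases "s $ i = 0")
    case False
    then have pos: "0 < s $ i" "0 < p $ i" using assms by (auto simp: less_le)
    define x where "x = sqrt (p $ i) / sqrt (s $ i)"
    have "0 < x" using pos by (simp add: x_def)
    have "ln (s $ i / p $ i) = - 2 * ln x"
      using pos by (simp add: x_def ln_div ln_sqrt)
    then have "2 - 2 * x \<le> ln (s $ i / p $ i)"
      using ln_le_minus_one[OF \<open>0 < x\<close>] by simp
    then have "s $ i * (2 - 2 * x) \<le> s $ i * ln (s $ i / p $ i)"
      using pos by (intro mult_left_mono) auto
    moreover have "s $ i * x = sqrt (s $ i) * sqrt (p $ i)"
      using pos by (simp add: x_def) (metis less_imp_le real_div_sqrt times_divide_eq_left)
    ultimately show ?thesis by (simp add: algebra_simps)
  qed simp
  \<comment> \<open>The added terms \<open>p $ i - s $ i\<close> complete the square and sum to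
    0.\<close>
  have "(\<Sum>i\<in>UNIV. (sqrt (s $ i) - sqrt (p $ i))\<^sup>2)
      = (\<Sum>i\<in>UNIV. (2 * s $ i - 2 * sqrt (s $ i) * sqrt (p $ i)) + (p $ i - s $ i))"
    by (intro sum.cong refl) (simp add: power2_diff assms)
  also have "\<dots> = (\<Sum>i\<in>UNIV. 2 * s $ i - 2 * sqrt (s $ i) * sqrt (p $ i))"
    unfolding sum.distrib sum_subtractf[where f = "\<lambda>i. p $ i"] using assms(4) by simp
  also have "\<dots> \<le> D s p"
    unfolding D_def by (intro sum_mono *)
  finally show ?thesis .
qed

lemma D_nonneg:
  fixes s p :: "real^'k"
  assumes "\<And>i. 0 \<le> s $ i" "\<And>i. 0 \<le> p $ i" "\<And>i. p $ i = 0 \<Longrightarrow> s $ i = 0" "total s = total p"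
  shows "0 \<le> D s p"
  using D_ge_hellinger[OF assms] by (meson order_trans sum_nonneg zero_le_power2)

text \<open>The Hellinger bound squeezes each difference of square roots to 0; squaring
  \<open>sqrt (p t $ i)\<close> then recovers the coordinate.\<close>

lemma tendsto_if_D_tendsto_0:
  fixes s :: "real^'k" and p :: "nat \<Rightarrow> real^'k"
  assumes s: "\<And>i. 0 \<le> s $ i" and p: "\<And>t i. 0 < p t $ i" and tot: "\<And>t. total s = total (p t)"
    and lim: "(\<lambda>t. D s (p t)) \<longlonglongrightarrow> 0"
  shows "p \<longlonglongrightarrow> s"
proof (rule vec_tendstoI)
  fix i
  have "(sqrt (s $ i) - sqrt (p t $ i))\<^sup>2 \<le> D s (p t)" for t
  proof -
    have "(sqrt (s $ i) - sqrt (p t $ i))\<^sup>2 \<le> (\<Sum>i\<in>UNIV. (sqrt (s $ i) - sqrt (p t $ i))\<^sup>2)"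
      by (intro member_le_sum) auto
    also have "\<dots> \<le> D s (p t)"
      using p[of t] s tot by (intro D_ge_hellinger) (auto simp: less_le)
    finally show ?thesis .
  qed
  then have "(\<lambda>t. (sqrt (s $ i) - sqrt (p t $ i))\<^sup>2) \<longlonglongrightarrow> 0"
    by (intro tendsto_sandwich[OF _ _ tendsto_const lim]) auto
  then have "(\<lambda>t. sqrt (s $ i) - sqrt (p t $ i)) \<longlonglongrightarrow> 0"
    by (simp add: tendsto_null_power)
  then have "(\<lambda>t. sqrt (s $ i) - (sqrt (s $ i) - sqrt (p t $ i))) \<longlonglongrightarrow> sqrt (s $ i) - 0"
    by (intro tendsto_intros)
  then have "(\<lambda>t. (sqrt (p t $ i))\<^sup>2) \<longlonglongrightarrow> (sqrt (s $ i))\<^sup>2"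
    by (intro tendsto_power) simp
  then show "(\<lambda>t. p t $ i) \<longlonglongrightarrow> s $ i"
    using s p by (simp add: less_imp_le)
qed

text \<open>Coordinates with \<open>s $ i = 0\<close> contribute exactly 0 for every
  \<open>t\<close>; in the others the ratio tends to 1, where \<open>ln\<close> is
  continuous.\<close>

lemma D_tendsto_0:
  fixes s :: "real^'k"
  assumes "p \<longlonglongrightarrow> s"
  shows "(\<lambda>t. D s (p t)) \<longlonglongrightarrow> 0"
proof -
  have "(\<lambda>t. s $ i * ln (s $ i / p t $ i)) \<longlonglongrightarrow> 0" for i
  proof (cases "s $ i = 0")
    case False
    then have "(\<lambda>t. s $ i * ln (s $ i / p t $ i)) \<longlonglongrightarrow> s $ i * ln (s $ i / s $ i)"
      by (intro tendsto_intros tendsto_vec_nth assms) auto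
    then show ?thesis using False by simp
  qed simp
  then show ?thesis unfolding D_def by (intro tendsto_null_sum) auto
qed

section \<open>Continuity of \<open>x * ln x\<close> and of entropy, including at 0\<close>

lemma abs_mult_ln_le:
  fixes x :: real
  assumes "0 \<le> x"
  shows "\<bar>x * ln x\<bar> \<le> 2 * sqrt x + x\<^sup>2"
proof (cases "x = 0")
  case False
  then have "0 < x" using assms by simp
  \<comment> \<open>The square root matters: \<open>ln y \<le> y - 1\<close> at
    \<open>y = 1 / x\<close> would bound \<open>- x * ln x\<close> only by \<open>1 - x\<close>,
    which does not vanish at 0.\<close>
  have "- ln x \<le> 2 / sqrt x"
    using ln_le_minus_one[of "1 / sqrt x"] \<open>0 < x\<close> by (simp add: ln_div ln_sqrt)
  then have "x * (- ln x) \<le> x * (2 / sqrt x)"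
    using \<open>0 < x\<close> by (intro mult_left_mono) auto
  also have "x * (2 / sqrt x) = 2 * sqrt x"
    using \<open>0 < x\<close> by (metis less_imp_le mult.commute real_div_sqrt times_divide_eq_left times_divide_eq_right)
  finally have 1: "- (x * ln x) \<le> 2 * sqrt x" by simp
  have "x * ln x \<le> x * x"
    using ln_le_minus_one[OF \<open>0 < x\<close>] \<open>0 < x\<close> by (intro mult_left_mono) auto
  then have 2: "x * ln x \<le> x\<^sup>2" by (simp add: power2_eq_square)
  have "0 \<le> sqrt x" "0 \<le> x\<^sup>2" using assms by auto
  then show ?thesis using 1 2 by linarith
qed simp

lemma tendsto_mult_ln:
  fixes a :: real
  assumes "x \<longlonglongrightarrow> a" "\<And>t. 0 \<le> x t"
  shows "(\<lambda>t. x t * ln (x t)) \<longlonglongrightarrow> a * ln a"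
proof (cases "a = 0")
  case True
  have "(\<lambda>t. 2 * sqrt (x t) + (x t)\<^sup>2) \<longlonglongrightarrow> 2 * sqrt a + a\<^sup>2"
    by (intro tendsto_intros assms)
  then have "(\<lambda>t. 2 * sqrt (x t) + (x t)\<^sup>2) \<longlonglongrightarrow> 0" using True by simp
  then have "(\<lambda>t. x t * ln (x t)) \<longlonglongrightarrow> 0"
    by (rule Lim_null_comparison[rotated]) (simp add: abs_mult_ln_le assms)
  then show ?thesis using True by simp
next
  case False
  then show ?thesis by (intro tendsto_intros assms)
qed

lemma H_tendsto:
  fixes q :: "real^'k"
  assumes "x \<longlonglongrightarrow> q" "\<And>t i. 0 \<le> x t $ i"
  shows "(\<lambda>t. H (x t)) \<longlonglongrightarrow> H q"
  unfolding H_def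
  by (intro tendsto_minus tendsto_sum tendsto_mult_ln tendsto_vec_nth assms)

section \<open>One step of the algorithm\<close>

locale channel =
  fixes V :: "real^'n^'m" and f :: "real^'n" and c :: "real^'m"
  assumes V_stoch: "stochastic V" and f_nonneg: "0 \<le> f"
begin

lemma V_nonneg: "0 \<le> V $ i $ j"
  using V_stoch by (simp add: stochastic_def less_eq_vec_def)

lemma V_row_sum: "(\<Sum>j\<in>UNIV. V $ i $ j) = 1"
  using V_stoch by (simp add: stochastic_def)

lemma f_nth_nonneg: "0 \<le> f $ j"
  using f_nonneg by (simp add: less_eq_vec_def)

definition out_dist :: "real^'m \<Rightarrow> real^'n" where
  "out_dist s = f + s v* V"

text \<open>Where all outputs are positive, this is the partial derivative of the objective in
  coordinate \<open>i\<close>, plus 1. The shift is the same for every \<open>i\<close> because the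
  rows of \<open>V\<close> sum to 1.\<close>

definition gain :: "real^'m \<Rightarrow> 'm \<Rightarrow> real" where
  "gain s i = c $ i - H (V $ i) - (\<Sum>j\<in>UNIV. V $ i $ j * ln (out_dist s $ j))"

abbreviation "J s \<equiv> I_fun s V f c"

section \<open>Support and total mass of the output vector\<close>

lemma out_dist_nth: "out_dist s $ j = f $ j + (\<Sum>i\<in>UNIV. s $ i * V $ i $ j)"
  by (simp add: out_dist_def vector_matrix_mult_def mult.commute)

lemma out_dist_nonneg: "0 \<le> s \<Longrightarrow> 0 \<le> out_dist s $ j"
  by (simp add: out_dist_nth less_eq_vec_def V_nonneg f_nth_nonneg sum_nonneg)

lemma out_dist_eq_0:
  assumes "0 \<le> s" "out_dist s $ j = 0"
  shows "f $ j = 0" "s $ i * V $ i $ j = 0"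
proof -
  have nn: "0 \<le> s $ i * V $ i $ j" for i
    using assms by (simp add: less_eq_vec_def V_nonneg)
  then have 0: "f $ j = 0 \<and> (\<Sum>i\<in>UNIV. s $ i * V $ i $ j) = 0"
    using assms(2) f_nth_nonneg[of j] by (simp add: out_dist_nth add_nonneg_eq_0_iff sum_nonneg)
  show "f $ j = 0" using 0 by simp
  show "s $ i * V $ i $ j = 0" using 0 nn by (simp add: sum_nonneg_eq_0_iff)
qed

text \<open>Since \<open>p\<close> has full support, a zero output at \<open>j\<close> forces both
  \<open>f $ j\<close> and column \<open>j\<close> of \<open>V\<close> to vanish. This is the
  absolute continuity that \<open>D (out_dist s) (out_dist p)\<close> requires.\<close>

lemma out_dist_eq_0_mono:
  assumes "\<And>i. 0 < p $ i" "out_dist p $ j = 0"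
  shows "out_dist s $ j = 0"
proof -
  have "0 \<le> p" using assms by (simp add: less_eq_vec_def less_imp_le)
  note z = out_dist_eq_0[OF this assms(2)]
  have "V $ i $ j = 0" for i using z(2)[of i] assms(1)[of i] by simp
  then show ?thesis using z(1) by (simp add: out_dist_nth)
qed

lemma total_out_dist: "total (out_dist s) = total f + total s"
proof -
  have "(\<Sum>j\<in>UNIV. \<Sum>i\<in>UNIV. s $ i * V $ i $ j) = (\<Sum>i\<in>UNIV. s $ i * (\<Sum>j\<in>UNIV. V $ i $ j))"
    by (subst sum.swap) (simp add: sum_distrib_left)
  then show ?thesis by (simp add: out_dist_nth sum.distrib V_row_sum)
qed

text \<open>Used with \<open>h\<close> the logarithm of an output vector, to turn sums over outputs
  into sums weighted by the inputs.\<close>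

lemma sum_out_dist_mult:
  "(\<Sum>j\<in>UNIV. out_dist s $ j * h j)
    = (\<Sum>j\<in>UNIV. f $ j * h j) + (\<Sum>i\<in>UNIV. s $ i * (\<Sum>j\<in>UNIV. V $ i $ j * h j))"
proof -
  have "(\<Sum>j\<in>UNIV. \<Sum>i\<in>UNIV. s $ i * V $ i $ j * h j) = (\<Sum>i\<in>UNIV. s $ i * (\<Sum>j\<in>UNIV. V $ i $ j * h j))"
    by (subst sum.swap) (simp add: sum_distrib_left mult.assoc)
  then show ?thesis by (simp add: out_dist_nth sum.distrib distrib_right sum_distrib_right)
qed

section \<open>Entropy form of the objective, its expansion, and data processing\<close>

lemma I_fun_eq:
  assumes "0 \<le> s"
  shows "J s = H (out_dist s) + (\<Sum>i\<in>UNIV. s $ i * (c $ i - H (V $ i))) - H f"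
proof -
  have ln_split: "a * ln (a / q) = a * ln a - a * ln q" if "0 \<le> a" "0 \<le> q" "q = 0 \<Longrightarrow> a = 0" for a q :: real
    using that by (cases "a = 0") (auto simp: ln_div less_le algebra_simps)
  have 1: "D f (out_dist s) = - H f - (\<Sum>j\<in>UNIV. f $ j * ln (out_dist s $ j))"
    using out_dist_eq_0(1)[OF assms] f_nth_nonneg out_dist_nonneg[OF assms]
    by (simp add: D_def H_def ln_split sum_subtractf)
  \<comment> \<open>If \<open>s $ i\<close> is nonzero, a zero output at \<open>j\<close> forces
    \<open>V $ i $ j = 0\<close>, so the logarithms split. If \<open>s $ i = 0\<close>, both sides
    vanish whatever default value the divergence takes.\<close>
  have 2: "s $ i * D (V $ i) (out_dist s)
      = s $ i * (- H (V $ i)) - s $ i * (\<Sum>j\<in>UNIV. V $ i $ j * ln (out_dist s $ j))" for i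
  proof (cases "s $ i = 0")
    case False
    then have "out_dist s $ j = 0 \<Longrightarrow> V $ i $ j = 0" for j
      using out_dist_eq_0(2)[OF assms, of j i] by simp
    then have "D (V $ i) (out_dist s) = - H (V $ i) - (\<Sum>j\<in>UNIV. V $ i $ j * ln (out_dist s $ j))"
      using V_nonneg out_dist_nonneg[OF assms] by (simp add: D_def H_def ln_split sum_subtractf)
    then show ?thesis by (simp only: right_diff_distrib)
  qed simp
  have "H (out_dist s) = - (\<Sum>j\<in>UNIV. f $ j * ln (out_dist s $ j))
      - (\<Sum>i\<in>UNIV. s $ i * (\<Sum>j\<in>UNIV. V $ i $ j * ln (out_dist s $ j)))"
    unfolding H_def sum_out_dist_mult by simp
  then show ?thesis
    unfolding I_fun_def out_dist_def[symmetric]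
    by (simp add: 1 2 distrib_left right_diff_distrib sum.distrib sum_subtractf sum_negf)
qed

text \<open>In the entropy form only \<open>H (out_dist s)\<close> is not affine in
  \<open>s\<close>, so the remainder of the first-order expansion is exactly the Bregman divergence
  of negative entropy between the outputs.\<close>

lemma I_fun_expand:
  assumes p: "\<And>i. 0 < p $ i" and s: "0 \<le> s"
  shows "J s = J p + (\<Sum>i\<in>UNIV. (s $ i - p $ i) * gain p i) - D (out_dist s) (out_dist p)"
proof -
  have p0: "0 \<le> p" using p by (simp add: less_eq_vec_def less_imp_le)
  have "out_dist s $ j * ln (out_dist s $ j / out_dist p $ j)
      = out_dist s $ j * ln (out_dist s $ j) - out_dist s $ j * ln (out_dist p $ j)" for j
    using out_dist_nonneg[OF s, of j] out_dist_nonneg[OF p0, of j] out_dist_eq_0_mono[OF p, of j s]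
    by (cases "out_dist s $ j = 0") (auto simp: ln_div less_le algebra_simps)
  then have "D (out_dist s) (out_dist p) = - H (out_dist s) - (\<Sum>j\<in>UNIV. out_dist s $ j * ln (out_dist p $ j))"
    by (simp add: D_def H_def sum_subtractf)
  then show ?thesis
    unfolding I_fun_eq[OF s] I_fun_eq[OF p0] H_def[of "out_dist p"] sum_out_dist_mult
    by (simp add: gain_def left_diff_distrib right_diff_distrib sum_subtractf)
qed

text \<open>Data processing: apply the log-sum inequality at each output, then sum over outputs
  using that the rows of \<open>V\<close> sum to 1. The offset \<open>f\<close> is common to both
  arguments, so its own term is 0.\<close>

lemma D_out_dist_le:
  assumes p: "\<And>i. 0 < p $ i" and s: "0 \<le> s"
  shows "D (out_dist s) (out_dist p) \<le> D s p"
proof -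
  have s': "0 \<le> s $ i" for i using s by (simp add: less_eq_vec_def)
  have "out_dist s $ j * ln (out_dist s $ j / out_dist p $ j)
      \<le> (\<Sum>i\<in>UNIV. s $ i * ln (s $ i / p $ i) * V $ i $ j)" for j
  proof -
    let ?a = "\<lambda>i. s $ i * V $ i $ j" and ?b = "\<lambda>i. p $ i * V $ i $ j"
    have z: "?b i = 0 \<Longrightarrow> ?a i = 0" for i using p[of i] by auto
    have nn: "0 \<le> ?a i" "0 \<le> ?b i" for i using p[of i] s' V_nonneg by (auto simp: less_imp_le)
    then have Z: "sum ?b UNIV = 0 \<Longrightarrow> sum ?a UNIV = 0"
      using z by (subst (asm) sum_nonneg_eq_0_iff) (auto intro!: sum.neutral)
    have "out_dist s $ j * ln (out_dist s $ j / out_dist p $ j)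
        \<le> f $ j * ln (f $ j / f $ j) + sum ?a UNIV * ln (sum ?a UNIV / sum ?b UNIV)"
      unfolding out_dist_nth using Z nn f_nth_nonneg
      by (intro log_sum_inequality2) (auto intro: sum_nonneg)
    also have "\<dots> = sum ?a UNIV * ln (sum ?a UNIV / sum ?b UNIV)"
      by (cases "f $ j = 0") auto
    also have "\<dots> \<le> (\<Sum>i\<in>UNIV. ?a i * ln (?a i / ?b i))"
      using nn z by (intro log_sum_inequality) auto
    \<comment> \<open>The factor \<open>V $ i $ j\<close> cancels inside the logarithm; where it is
      0, both terms are 0.\<close>
    also have "\<dots> = (\<Sum>i\<in>UNIV. s $ i * ln (s $ i / p $ i) * V $ i $ j)"
      by (intro sum.cong refl) (simp add: field_simps)
    finally show ?thesis .
  qed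
  then have "D (out_dist s) (out_dist p) \<le> (\<Sum>j\<in>UNIV. \<Sum>i\<in>UNIV. s $ i * ln (s $ i / p $ i) * V $ i $ j)"
    unfolding D_def by (intro sum_mono)
  also have "\<dots> = D s p"
    by (subst sum.swap) (simp add: D_def sum_distrib_left[symmetric] V_row_sum)
  finally show ?thesis .
qed

text \<open>Splitting \<open>ln (Phi p V f $ j $ i)\<close> isolates \<open>ln (p $ i)\<close> with
  weight 1, the row sum; the rest is \<open>gain\<close>. Exponentiating makes the update
  multiplicative in \<open>p $ i\<close>.\<close>

lemma exponent_eq:
  assumes p: "\<And>i. 0 < p $ i"
  shows "c $ i + (\<Sum>j\<in>UNIV. V $ i $ j * ln (Phi p V f $ j $ i)) = ln (p $ i) + gain p i"
proof -
  have p0: "0 \<le> p" using p by (simp add: less_eq_vec_def less_imp_le)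
  have "V $ i $ j * ln (Phi p V f $ j $ i)
      = V $ i $ j * ln (p $ i) + V $ i $ j * ln (V $ i $ j) - V $ i $ j * ln (out_dist p $ j)" for j
  proof (cases "V $ i $ j = 0")
    case False
    then have V: "0 < V $ i $ j" using V_nonneg[of i j] by simp
    then have "out_dist p $ j \<noteq> 0" using out_dist_eq_0(2)[OF p0, of j i] p[of i] by auto
    then have "0 < out_dist p $ j" using out_dist_nonneg[OF p0, of j] by simp
    moreover have "Phi p V f $ j $ i = p $ i * V $ i $ j / out_dist p $ j"
      by (simp add: Phi_def out_dist_nth)
    ultimately show ?thesis using V p[of i] by (simp add: ln_div ln_mult algebra_simps)
  qed simp
  then have "(\<Sum>j\<in>UNIV. V $ i $ j * ln (Phi p V f $ j $ i))
      = (\<Sum>j\<in>UNIV. V $ i $ j) * ln (p $ i) - H (V $ i) - (\<Sum>j\<in>UNIV. V $ i $ j * ln (out_dist p $ j))"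
    by (simp add: H_def sum.distrib sum_subtractf sum_distrib_right)
  then show ?thesis by (simp add: gain_def V_row_sum)
qed

lemma step_inequality:
  assumes p: "\<And>i. 0 < p $ i" "total p = 1"
    and p': "\<And>i. p' $ i = max (r $ i) (\<alpha> * (p $ i * exp (gain p i)))" "total p' = 1" and "0 < \<alpha>"
    and s: "s \<in> Omega_ge r"
  shows "J s - J p' \<le> D s p - D s p'"
proof -
  have s0: "0 \<le> s" and s1: "total s = 1" and sr: "r $ i \<le> s $ i" for i
    using s by (auto simp: Omega_ge_def Omega_def less_eq_vec_def)
  have p'_pos: "0 < p' $ i" for i
    using p(1)[of i] \<open>0 < \<alpha>\<close> by (simp add: p'(1) less_max_iff_disj)
  have p'0: "0 \<le> p'" using p'_pos by (simp add: less_eq_vec_def less_imp_le)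
  \<comment> \<open>The excess of \<open>ln (p' $ i / p $ i)\<close> over \<open>ln \<alpha> + gain p i\<close> is a Lagrange multiplier for
    the constraint $p'_i \ge r_i$: it is nonnegative, and it vanishes unless $p'_i = r_i$.\<close>
  have kkt: "(s $ i - p' $ i) * (ln \<alpha> + gain p i) \<le> (s $ i - p' $ i) * ln (p' $ i / p $ i)" for i
  proof -
    let ?e = "\<alpha> * (p $ i * exp (gain p i))"
    have e: "ln (?e / p $ i) = ln \<alpha> + gain p i" and "0 < ?e"
      using p(1)[of i] \<open>0 < \<alpha>\<close> by (auto simp: ln_mult)
    show ?thesis
    proof (cases "?e < r $ i")
      case True
      then have "p' $ i = r $ i" using p'(1)[of i] by simp
      moreover have "ln (?e / p $ i) \<le> ln (r $ i / p $ i)"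
        using True \<open>0 < ?e\<close> p(1)[of i] by (intro ln_mono divide_right_mono divide_pos_pos) auto
      ultimately show ?thesis using sr[of i] e by (simp add: mult_left_mono)
    next
      case False
      then have "p' $ i = ?e" using p'(1)[of i] by simp
      then show ?thesis using e by simp
    qed
  qed
  \<comment> \<open>The constant \<open>ln \<alpha>\<close> can be inserted because \<open>s\<close>
    and \<open>p'\<close> have equal totals.\<close>
  have "(\<Sum>i\<in>UNIV. (s $ i - p' $ i) * gain p i) = (\<Sum>i\<in>UNIV. (s $ i - p' $ i) * (ln \<alpha> + gain p i))"
    using s1 p'(2) by (simp add: distrib_left sum.distrib sum_distrib_right[symmetric] sum_subtractf)
  also have "\<dots> \<le> (\<Sum>i\<in>UNIV. (s $ i - p' $ i) * ln (p' $ i / p $ i))"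
    by (intro sum_mono kkt)
  \<comment> \<open>The three-point identity for relative entropy.\<close>
  also have "\<dots> = D s p - D s p' - D p' p"
  proof -
    have "s $ i * ln (s $ i / p $ i) - s $ i * ln (s $ i / p' $ i) = s $ i * ln (p' $ i / p $ i)" for i
    proof (cases "s $ i = 0")
      case False
      moreover have "0 \<le> s $ i" using s0 by (simp add: less_eq_vec_def)
      ultimately have "0 < s $ i" by simp
      then show ?thesis using p(1)[of i] p'_pos[of i] by (simp add: ln_div algebra_simps)
    qed simp
    then show ?thesis by (simp add: D_def sum_subtractf[symmetric] left_diff_distrib)
  qed
  finally have three_point: "(\<Sum>i\<in>UNIV. (s $ i - p' $ i) * gain p i) \<le> D s p - D s p' - D p' p" .
  have "0 \<le> D (out_dist s) (out_dist p)"
    using p s0 s1 out_dist_eq_0_mono[OF p(1)] by (intro D_nonneg out_dist_nonneg)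
      (simp_all add: total_out_dist less_eq_vec_def less_imp_le)
  \<comment> \<open>The term \<open>- D p' p\<close> from the three-point bound pays for the
    remainder of the expansion at \<open>p'\<close>; this is why step size 1 works.\<close>
  moreover have "D (out_dist p') (out_dist p) \<le> D p' p"
    using p p'0 by (intro D_out_dist_le) auto
  moreover have "(\<Sum>i\<in>UNIV. (s $ i - p $ i) * gain p i) - (\<Sum>i\<in>UNIV. (p' $ i - p $ i) * gain p i)
      = (\<Sum>i\<in>UNIV. (s $ i - p' $ i) * gain p i)"
    by (simp add: sum_subtractf[symmetric] algebra_simps)
  ultimately show ?thesis
    using three_point I_fun_expand[OF p(1) s0] I_fun_expand[OF p(1) p'0] by linarith
qed

text \<open>The entropy form is used because it stays continuous where outputs vanish, while
  individual divergences in the definition of \<open>I_fun\<close> may not.\<close>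

lemma I_fun_tendsto:
  assumes "x \<longlonglongrightarrow> s" "\<And>t. 0 \<le> x t" "0 \<le> s"
  shows "(\<lambda>t. J (x t)) \<longlonglongrightarrow> J s"
proof -
  have out_lim: "(\<lambda>t. out_dist (x t)) \<longlonglongrightarrow> out_dist s"
    by (intro vec_tendstoI, unfold out_dist_nth) (intro tendsto_intros tendsto_vec_nth assms)
  show ?thesis
    unfolding I_fun_eq[OF assms(2)] I_fun_eq[OF assms(3)]
    by (intro tendsto_intros H_tendsto out_lim out_dist_nonneg assms tendsto_vec_nth)
qed

end

section \<open>Convergence\<close>

text \<open>Since \<open>t \<le> k t\<close>, the limit along the subsequence bounds the whole
  sequence, which therefore converges, necessarily to \<open>l\<close>. It serves both for the
  objective values and for the negated divergences.\<close>

lemma incseq_LIMSEQ_subseq: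
  fixes x :: "nat \<Rightarrow> real"
  assumes inc: "incseq x" and k: "strict_mono k" and lim: "(\<lambda>t. x (k t)) \<longlonglongrightarrow> l"
  shows "x \<longlonglongrightarrow> l"
proof -
  have "incseq (\<lambda>t. x (k t))"
    using inc k by (auto simp: incseq_def strict_mono_less_eq)
  then have "x (k t) \<le> l" for t
    using incseq_le[OF _ lim] by blast
  then have "x t \<le> l" for t
    using incseqD[OF inc seq_suble[OF k]] order_trans by blast
  then obtain l' where l': "x \<longlonglongrightarrow> l'"
    using incseq_convergent[OF inc] by blast
  then show ?thesis
    using LIMSEQ_unique[OF LIMSEQ_subseq_LIMSEQ[OF l' k]] lim by (auto simp: o_def)
qed

section \<open>The transformed matrix and the feasible set\<close>

lemma W_tilde_nth:
  "W_tilde W r f $ i $ j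
    = (1 + total f) / (1 - total r) * (W $ i $ j - (\<Sum>k\<in>UNIV. r $ k * W $ k $ j)) - f $ j"
proof -
  have "((mat 1 - (\<chi> i. r)) ** W) $ i $ j = W $ i $ j - (\<Sum>k\<in>UNIV. r $ k * W $ k $ j)"
    by (simp add: matrix_matrix_mult_def mat_def left_diff_distrib sum_subtractf
        if_distrib[of "\<lambda>x. x * _"] cong: if_cong)
  then show ?thesis by (simp add: W_tilde_def)
qed

lemma stochastic_W_tilde:
  assumes "stochastic W" "admissible W r f"
  shows "stochastic (W_tilde W r f)"
proof -
  have W: "(\<Sum>j\<in>UNIV. W $ i $ j) = 1" for i using assms by (simp add: stochastic_def)
  have "(\<Sum>j\<in>UNIV. \<Sum>k\<in>UNIV. r $ k * W $ k $ j) = total r"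
    by (subst sum.swap) (simp add: sum_distrib_left[symmetric] W)
  then have "(\<Sum>j\<in>UNIV. W $ i $ j - (\<Sum>k\<in>UNIV. r $ k * W $ k $ j)) = 1 - total r" for i
    by (simp add: sum_subtractf W)
  then have "total (W_tilde W r f $ i) = 1" for i
    unfolding W_tilde_nth sum_subtractf[where g = "\<lambda>j. f $ j"] sum_distrib_left[symmetric]
    using assms(2) by (simp add: admissible_def)
  then show ?thesis using assms(2) by (simp add: stochastic_def admissible_def)
qed

lemma compact_Omega_ge: "compact (Omega_ge (r :: real^'m))"
proof -
  have "bounded (Omega_ge r)"
  proof (rule boundedI)
    fix p assume p: "p \<in> Omega_ge r"
    have "norm p \<le> (\<Sum>i\<in>UNIV. \<bar>p $ i\<bar>)" by (rule norm_le_l1_cart)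
    also have "\<dots> = 1" using p by (auto simp: Omega_ge_def Omega_def less_eq_vec_def)
    finally show "norm p \<le> 1" .
  qed
  moreover have "Omega_ge r = {p. total p = 1} \<inter> (\<Inter>i. {p. 0 \<le> p $ i} \<inter> {p. r $ i \<le> p $ i})"
    by (auto simp: Omega_ge_def Omega_def less_eq_vec_def)
  then have "closed (Omega_ge r)"
    by (auto intro!: closed_Int closed_INT closed_Collect_eq closed_Collect_le continuous_intros)
  ultimately show ?thesis by (simp add: compact_eq_bounded_closed)
qed

theorem theorem1:
  fixes W :: "real^'n^'m" and r :: "real^'m" and f :: "real^'n" and p :: "nat \<Rightarrow> real^'m"
  assumes "stochastic W"
    and "\<exists>i k. W $ i \<noteq> W $ k"
    and "\<forall>j. column j W \<noteq> 0"
    and "admissible W r f"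
    and "algorithm_III W r f p"
  shows "convergent p
    \<and> incseq (\<lambda>t. I_fun (p t) (W_tilde W r f) f (c_vec W r f))
    \<and> bdd_above ((\<lambda>q. I_fun q (W_tilde W r f) f (c_vec W r f)) ` Omega_ge r)
    \<and> (\<lambda>t. I_fun (p t) (W_tilde W r f) f (c_vec W r f))
        \<longlonglongrightarrow> (SUP q\<in>Omega_ge r. I_fun q (W_tilde W r f) f (c_vec W r f))"
proof -
  interpret channel "W_tilde W r f" f "c_vec W r f"
    using assms stochastic_W_tilde by unfold_locales (auto simp: admissible_def)
  have p_step: "\<exists>\<alpha>>0. (\<forall>i. p (Suc t) $ i = max (r $ i) (\<alpha> * exp (c_vec W r f $ i +
        (\<Sum>j\<in>UNIV. W_tilde W r f $ i $ j * ln (Phi (p t) (W_tilde W r f) f $ j $ i)))))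
      \<and> total (p (Suc t)) = 1" for t
    using assms(5) by (simp add: algorithm_III_def)
  have p_pos: "0 < p t $ i" for t i
  proof (cases t)
    case 0
    then show ?thesis using assms(5) by (simp add: algorithm_III_def)
  next
    case (Suc t')
    then show ?thesis using p_step[of t'] by (auto simp: less_max_iff_disj)
  qed
  then have p_nonneg: "0 \<le> p t" for t by (simp add: less_eq_vec_def less_imp_le)
  have p_in: "p t \<in> Omega_ge r" for t
  proof (cases t)
    case 0
    then show ?thesis using assms(5) by (simp add: algorithm_III_def)
  next
    case (Suc t')
    then have "total (p t) = 1" "r $ i \<le> p t $ i" for i using p_step[of t'] by auto
    then show ?thesis using p_nonneg by (simp add: Omega_ge_def Omega_def less_eq_vec_def[of r])
  qed
  have p_total: "total (p t) = 1" for t using p_in[of t] by (simp add: Omega_ge_def Omega_def)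
  have step: "J s - J (p (Suc t)) \<le> D s (p t) - D s (p (Suc t))" if "s \<in> Omega_ge r" for s t
  proof -
    \<comment> \<open>The update is rewritten in multiplicative form, as the one-step inequality
      expects.\<close>
    obtain \<alpha> where "0 < \<alpha>" and \<alpha>: "p (Suc t) $ i = max (r $ i) (\<alpha> * exp (ln (p t $ i) + gain (p t) i))" for i
      using p_step[of t] by (auto simp: exponent_eq[OF p_pos])
    have "p (Suc t) $ i = max (r $ i) (\<alpha> * (p t $ i * exp (gain (p t) i)))" for i
      unfolding \<alpha>[of i] using p_pos[of t i] by (simp add: exp_add)
    then show ?thesis
      using step_inequality[OF p_pos p_total _ p_total \<open>0 < \<alpha>\<close> that] by blast
  qed
  have D_nn: "0 \<le> D s (p t)" if "s \<in> Omega_ge r" for s t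
    using that p_pos[of t] p_total[of t] by (intro D_nonneg)
      (auto simp: Omega_ge_def Omega_def less_eq_vec_def less_imp_le less_le)
  have D_self: "D s s = 0" for s :: "real^'m"
    unfolding D_def by (intro sum.neutral) (auto simp: divide_self_if)
  have inc: "incseq (\<lambda>t. J (p t))"
  proof (rule incseq_SucI)
    fix t
    show "J (p t) \<le> J (p (Suc t))"
      using step[OF p_in, of t t] D_nn[OF p_in, of t "Suc t"] by (simp add: D_self)
  qed
  obtain s k where s: "s \<in> Omega_ge r" and k: "strict_mono k" and lim: "(p \<circ> k) \<longlonglongrightarrow> s"
    using compact_Omega_ge[of r] p_in by (metis compact_def)
  have s0: "0 \<le> s" and s1: "total s = 1" using s by (auto simp: Omega_ge_def Omega_def)
  have lim': "(\<lambda>t. p (k t)) \<longlonglongrightarrow> s" using lim by (simp add: o_def)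
  have "(\<lambda>t. J (p (k t))) \<longlonglongrightarrow> J s"
    by (intro I_fun_tendsto lim' p_nonneg s0)
  then have J_lim: "(\<lambda>t. J (p t)) \<longlonglongrightarrow> J s"
    by (rule incseq_LIMSEQ_subseq[OF inc k])
  have J_le: "J (p t) \<le> J s" for t using incseq_le[OF inc J_lim] .
  have max: "J q \<le> J s" if "q \<in> Omega_ge r" for q
  proof -
    \<comment> \<open>Telescoping: each step gains at least \<open>J q - J s\<close>, because
      \<open>J (p (Suc n)) \<le> J s\<close>. A positive gap would make the left side exceed the
      fixed bound \<open>D q (p 0)\<close>.\<close>
    have sum_le: "real n * (J q - J s) \<le> D q (p 0) - D q (p n)" for n
    proof (induction n)
      case (Suc n)
      then show ?case using step[OF that, of n] J_le[of "Suc n"] by (simp add: algebra_simps)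
    qed simp
    have "real n * (J q - J s) \<le> D q (p 0)" for n
      using sum_le[of n] D_nn[OF that, of n] by linarith
    then have "\<not> 0 < J q - J s"
      using ex_less_of_nat_mult[of "J q - J s" "D q (p 0)"] by (metis not_le)
    then show ?thesis by simp
  qed
  have "(SUP q\<in>Omega_ge r. J q) = J s"
    using s max by (intro cSup_eq_maximum) auto
  moreover have "bdd_above (J ` Omega_ge r)"
    using max by (intro bdd_aboveI2)
  moreover have "convergent p"
  proof -
    \<comment> \<open>With \<open>q = s\<close> the left side of the step inequality is nonnegative,
      so the divergence from \<open>s\<close> cannot grow. Its limit 0 along the subsequence then
      passes to the whole sequence.\<close>
    have dec: "decseq (\<lambda>t. D s (p t))"
    proof (rule decseq_SucI)
      fix t
      show "D s (p (Suc t)) \<le> D s (p t)" using step[OF s, of t] J_le[of "Suc t"] by simp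
    qed
    have "(\<lambda>t. D s (p (k t))) \<longlonglongrightarrow> 0" by (rule D_tendsto_0[OF lim'])
    then have "(\<lambda>t. - D s (p (k t))) \<longlonglongrightarrow> - 0"
      by (rule tendsto_minus)
    moreover have "incseq (\<lambda>t. - D s (p t))"
      using dec by (simp add: incseq_def decseq_def)
    ultimately have "(\<lambda>t. - D s (p t)) \<longlonglongrightarrow> - 0"
      using k incseq_LIMSEQ_subseq by blast
    then have "(\<lambda>t. D s (p t)) \<longlonglongrightarrow> 0"
      by (rule tendsto_minus_cancel)
    then have "p \<longlonglongrightarrow> s"
      using s0 s1 p_total p_pos by (intro tendsto_if_D_tendsto_0) (auto simp: less_eq_vec_def)
    then show ?thesis by (rule convergentI)
  qed
  ultimately show ?thesis using J_lim inc by simp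
qed

end
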